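(* Let $N\in\mathbb N$, $\alpha\in(0,N)$ and $p\ge1$. Assume that $(u_n)_{n\in\mathbb N}$ is a sequence of measurable functions from $\mathbb R^N$ to $\mathbb R$ that converges to $u:\mathbb R^N\to\mathbb R$ almost everywhere. If the sequence $(I_{\alpha/2}*|u_n|^p)_{n\in\mathbb N}$ is bounded in $L^2(\mathbb R^N)$, then $$\lim_{n\to\infty}\int_{\mathbb R^N}\Bigl|\,\bigl|I_{\alpha/2}*|u_n|^p\bigr|^2-\bigl|I_{\alpha/2}*(|u_n-u|^p+|u|^p)\bigr|^2\Bigr|=0.$$
   Context: $\mathbb N$ denotes the positive integers. For $\alpha\in(0,N)$ the Riesz potential is $I_\alpha(x)=A_\alpha|x|^{-(N-\alpha)}$ for $x\in\mathbb R^N\setminus\{0\}$, with $A_\alpha=\frac{\Gamma((N-\alpha)/2)}{\Gamma(\alpha/2)\pi^{N/2}2^\alpha}$ (so $I_{\alpha/2}(x)=A_{\alpha/2}|x|^{-(N-\alpha/2)}$). *)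

theory Defs
  imports "HOL-Analysis.Analysis"
begin

definition riesz_const :: "nat \<Rightarrow> real \<Rightarrow> real" where
  "riesz_const N \<alpha> =
     Gamma ((real N - \<alpha>) / 2) / (Gamma (\<alpha> / 2) * pi powr (real N / 2) * 2 powr \<alpha>)"

text \<open>The kernel is only meant for nonzero arguments; at the origin the conventions for
  \<^const>\<open>powr\<close> give the value 0, which does not affect any integral.\<close>

definition riesz_kernel :: "real \<Rightarrow> real ^ 'n \<Rightarrow> real" where
  "riesz_kernel \<alpha> x = riesz_const CARD('n) \<alpha> * norm x powr (- (real CARD('n) - \<alpha>))"

text \<open>The convolution of the kernel with a nonnegative function is taken in
  \<^typ>\<open>ennreal\<close>. A divergent integral thus gives \<open>\<infinity>\<close> (with the Bochner integral it would
  silently become 0, and an infinite potential would count as square integrable).\<close>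

definition riesz_conv :: "real \<Rightarrow> (real ^ 'n \<Rightarrow> ennreal) \<Rightarrow> real ^ 'n \<Rightarrow> ennreal" where
  "riesz_conv \<alpha> f x = (\<integral>\<^sup>+ y. ennreal (riesz_kernel \<alpha> (x - y)) * f y \<partial>lebesgue)"

text \<open>Boundedness in \<open>L\<^sup>2\<close> of a sequence of nonnegative extended-real-valued functions; the bound
  \<open>C\<close> is one for the norms, hence its square. In particular every \<open>F n\<close> is finite almost
  everywhere.\<close>

definition L2_bounded :: "(nat \<Rightarrow> real ^ 'n \<Rightarrow> ennreal) \<Rightarrow> bool" where
  "L2_bounded F \<longleftrightarrow> (\<forall>n. F n \<in> borel_measurable lebesgue) \<and>
     (\<exists>C::real. \<forall>n. (\<integral>\<^sup>+ x. (F n x)\<^sup>2 \<partial>lebesgue) \<le> ennreal (C\<^sup>2))"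

text \<open>The absolute difference \<open>\<bar>a - b\<bar>\<close> of two elements of \<open>[0, \<infinity>]\<close>. By the conventions for
  \<^typ>\<open>ereal\<close>, \<open>\<infinity> - \<infinity> = \<infinity>\<close>, so a vanishing limit of integrals of such differences
  can never come from points where both terms are infinite.\<close>

definition ennreal_abs_diff :: "ennreal \<Rightarrow> ennreal \<Rightarrow> ennreal" where
  "ennreal_abs_diff a b = e2ennreal \<bar>enn2ereal a - enn2ereal b\<bar>"

lemma ennreal_abs_diff_ennreal:
  assumes "0 \<le> a" "0 \<le> b"
  shows "ennreal_abs_diff (ennreal a) (ennreal b) = ennreal \<bar>a - b\<bar>"
  using assms by (simp add: ennreal_abs_diff_def enn2ereal_ennreal)

lemma ennreal_abs_diff_top: "ennreal_abs_diff \<infinity> \<infinity> = \<infinity>"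
proof -
  have "enn2ereal \<infinity> = \<infinity>"
    by (simp flip: top_ereal_def)
  moreover have "e2ennreal \<infinity> = \<infinity>"
    using e2ennreal_enn2ereal[of "\<infinity>"] calculation by simp
  ultimately show ?thesis
    by (simp add: ennreal_abs_diff_def)
qed

end

theory Submission
  imports Defs
begin

text \<open>
  Write \<open>T\<close> for the convolution with the kernel, \<open>f\<^sub>n = \<bar>u\<^sub>n\<bar>\<^sup>p\<close>, \<open>h = \<bar>v\<bar>\<^sup>p\<close> and
  \<open>g\<^sub>n = \<bar>u\<^sub>n - v\<bar>\<^sup>p + h\<close>, so that \<open>f\<^sub>n\<close> and \<open>g\<^sub>n\<close> both tend to \<open>h\<close> almost everywhere. As in the
  classical lemma of Brezis and Lieb, everything rests on the elementary inequality
  \<open>\<bar>f\<^sub>n - g\<^sub>n\<bar> \<le> e f\<^sub>n + C h\<close>, with \<open>e\<close> as small as desired and \<open>C\<close> depending on \<open>e\<close>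
  (\<open>powr_splitting\<close>). It says that the excess \<open>\<psi>\<^sub>n = max 0 (\<bar>f\<^sub>n - g\<^sub>n\<bar> - e f\<^sub>n)\<close> is dominated by
  the fixed function \<open>C h\<close>, and this excess tends to 0 almost everywhere.

  By Fatou's lemma \<open>T h\<close> is square integrable (\<open>potential_square_Fatou\<close>). Dominated convergence,
  once inside \<open>T\<close> at every point where \<open>T h\<close> is finite and once for the outer integral, then gives
  \<open>\<integral>(T \<psi>\<^sub>n)\<^sup>2 \<rightarrow> 0\<close> (\<open>potential_square_dominated\<close>).

  Since \<open>T\<close> is additive and monotone, \<open>\<bar>T f\<^sub>n - T g\<^sub>n\<bar> \<le> e T f\<^sub>n + T \<psi>\<^sub>n\<close>, and hence
  \<open>\<bar>(T f\<^sub>n)\<^sup>2 - (T g\<^sub>n)\<^sup>2\<bar> \<le> 4 e (T f\<^sub>n)\<^sup>2 + (1 + 4/e) (T \<psi>\<^sub>n)\<^sup>2\<close> wherever \<open>T f\<^sub>n\<close> is finite, that is,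
  almost everywhere. The integral of the first term is at most \<open>4 e\<close> times the uniform bound, that
  of the second one vanishes in the limit, and \<open>e\<close> is arbitrary. The argument
  is carried out for an arbitrary nonnegative, finite and measurable kernel
  (\<open>square_potential_splitting\<close>).
\<close>

section \<open>The splitting inequality for powers\<close>

text \<open>By homogeneity only the ratio \<open>t = b / a\<close> matters. For small \<open>t\<close> the left-hand side is a small
  multiple of \<open>\<bar>a\<bar>\<^sup>p\<close> by continuity at 0; otherwise \<open>\<bar>a\<bar>\<close> is at most a constant times \<open>\<bar>b\<bar>\<close> and
  each of the three powers is absorbed into \<open>C \<bar>b\<bar>\<^sup>p\<close>.\<close>

lemma powr_splitting:
  fixes p e :: real
  assumes "0 < p" "0 < e"
  shows "\<exists>C\<ge>0. \<forall>a b::real.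
    \<bar>\<bar>a\<bar> powr p - (\<bar>a - b\<bar> powr p + \<bar>b\<bar> powr p)\<bar> \<le> e * \<bar>a\<bar> powr p + C * \<bar>b\<bar> powr p"
proof -
  define \<phi> where "\<phi> t = \<bar>1 - (\<bar>1 - t\<bar> powr p + \<bar>t\<bar> powr p)\<bar>" for t :: real
  have "(\<phi> \<longlongrightarrow> \<phi> 0) (at 0)"
    unfolding \<phi>_def using \<open>0 < p\<close>
    by (intro tendsto_rabs tendsto_diff tendsto_add tendsto_powr' tendsto_const tendsto_ident_at)
       auto
  moreover have \<phi>0: "\<phi> 0 = 0"
    by (simp add: \<phi>_def)
  ultimately have "\<forall>\<^sub>F t in at 0. \<phi> t < e"
    using \<open>0 < e\<close> order_tendstoD(2)[of \<phi> 0 "at 0" e] by simp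
  then obtain d where "0 < d" and small: "\<And>t. t \<noteq> 0 \<Longrightarrow> \<bar>t\<bar> < d \<Longrightarrow> \<phi> t < e"
    unfolding eventually_at dist_real_def by auto
  have \<phi>_less: "\<phi> t < e" if "\<bar>t\<bar> < d" for t
    using small[OF _ that] \<phi>0 \<open>0 < e\<close> by (cases "t = 0") auto
  define C where "C = (1 / d) powr p + (1 / d + 1) powr p + 1"
  have "\<bar>\<bar>a\<bar> powr p - (\<bar>a - b\<bar> powr p + \<bar>b\<bar> powr p)\<bar> \<le> e * \<bar>a\<bar> powr p + C * \<bar>b\<bar> powr p"
    for a b :: real
  proof (cases "\<bar>b\<bar> < d * \<bar>a\<bar>")
    case True
    then have a: "a \<noteq> 0" using abs_ge_zero[of b] by (intro notI) simp
    define t where "t = b / a"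
    have b: "b = t * a" using a by (simp add: t_def)
    have t: "\<bar>t\<bar> < d" using True a by (simp add: t_def divide_simps abs_divide)
    have "a - b = (1 - t) * a" by (simp add: b algebra_simps)
    then have "\<bar>a - b\<bar> powr p = \<bar>1 - t\<bar> powr p * \<bar>a\<bar> powr p"
      by (simp add: abs_mult powr_mult)
    moreover have "\<bar>b\<bar> powr p = \<bar>t\<bar> powr p * \<bar>a\<bar> powr p"
      by (simp add: b abs_mult powr_mult)
    ultimately have "\<bar>a\<bar> powr p - (\<bar>a - b\<bar> powr p + \<bar>b\<bar> powr p)
        = (1 - (\<bar>1 - t\<bar> powr p + \<bar>t\<bar> powr p)) * \<bar>a\<bar> powr p"
      by (simp add: left_diff_distrib distrib_right)
    then have "\<bar>\<bar>a\<bar> powr p - (\<bar>a - b\<bar> powr p + \<bar>b\<bar> powr p)\<bar> = \<phi> t * \<bar>a\<bar> powr p"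
      by (simp add: \<phi>_def abs_mult)
    also have "\<dots> \<le> e * \<bar>a\<bar> powr p"
      using \<phi>_less[OF t] by (intro mult_right_mono) auto
    also have "\<dots> \<le> e * \<bar>a\<bar> powr p + C * \<bar>b\<bar> powr p"
      by (simp add: C_def)
    finally show ?thesis .
  next
    case False
    then have a: "\<bar>a\<bar> \<le> (1 / d) * \<bar>b\<bar>"
      using \<open>0 < d\<close> by (simp add: field_simps)
    then have "\<bar>a - b\<bar> \<le> (1 / d + 1) * \<bar>b\<bar>"
      by (simp add: algebra_simps)
    then have "\<bar>a - b\<bar> powr p \<le> (1 / d + 1) powr p * \<bar>b\<bar> powr p"
      using \<open>0 < p\<close> \<open>0 < d\<close> by (subst powr_mult[symmetric]) (auto intro!: powr_mono2)
    moreover have "\<bar>a\<bar> powr p \<le> (1 / d) powr p * \<bar>b\<bar> powr p"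
      using a \<open>0 < p\<close> \<open>0 < d\<close> by (subst powr_mult[symmetric]) (auto intro!: powr_mono2)
    ultimately have "\<bar>a\<bar> powr p + \<bar>a - b\<bar> powr p + \<bar>b\<bar> powr p \<le> C * \<bar>b\<bar> powr p"
      by (simp add: C_def distrib_right)
    moreover have "0 \<le> e * \<bar>a\<bar> powr p" using \<open>0 < e\<close> by simp
    moreover have "0 \<le> \<bar>a\<bar> powr p" "0 \<le> \<bar>a - b\<bar> powr p" "0 \<le> \<bar>b\<bar> powr p" by auto
    ultimately show ?thesis by linarith
  qed
  moreover have "0 \<le> C" by (simp add: C_def)
  ultimately show ?thesis by blast
qed

section \<open>Squares in the extended nonnegative reals\<close>

text \<open>Factor the difference of squares; \<open>a + b\<close> is at most \<open>3 a + r\<close>, and the mixed term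
  \<open>4 a r\<close> is split by Young's inequality with weight \<open>e\<close>. The right-hand side thus contains only
  squares, and it can be integrated term by term.\<close>

lemma square_diff_le_of_close:
  fixes a b r e :: real
  assumes "0 \<le> a" "0 \<le> b" "0 \<le> r" "0 < e" "e \<le> 1" "\<bar>a - b\<bar> \<le> e * a + r"
  shows "\<bar>a\<^sup>2 - b\<^sup>2\<bar> \<le> 4 * e * a\<^sup>2 + (1 + 4 / e) * r\<^sup>2"
proof -
  have ea: "e * a \<le> a" using assms by (simp add: mult_left_le_one_le)
  have "\<bar>a\<^sup>2 - b\<^sup>2\<bar> = \<bar>a - b\<bar> * (a + b)"
    using assms by (simp add: power2_eq_square abs_mult square_diff_square_factored)
  also have "\<dots> \<le> (e * a + r) * (3 * a + r)"
    using assms ea by (intro mult_mono) auto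
  also have "\<dots> = 3 * e * a\<^sup>2 + (e * a + 3 * a) * r + r\<^sup>2"
    by (simp add: power2_eq_square algebra_simps)
  also have "\<dots> \<le> 3 * e * a\<^sup>2 + 4 * (a * r) + r\<^sup>2"
    using mult_right_mono[of "e * a + 3 * a" "4 * a" r] ea assms by simp
  also have "4 * (a * r) \<le> e * a\<^sup>2 + 4 / e * r\<^sup>2"
  proof -
    have "0 \<le> (e * a - 2 * r)\<^sup>2 / e" using assms by simp
    also have "\<dots> = e * a\<^sup>2 + 4 / e * r\<^sup>2 - 4 * (a * r)"
      using assms by (simp add: power2_eq_square field_simps)
    finally show ?thesis by simp
  qed
  finally show ?thesis by (simp add: algebra_simps)
qed

lemma ennreal_square_diff_le_of_close:
  fixes a b r :: ennreal and e :: real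
  assumes e: "0 < e" "e \<le> 1" and a: "a < \<infinity>"
    and ab: "a \<le> b + ennreal e * a + r" and ba: "b \<le> a + ennreal e * a + r"
  shows "ennreal_abs_diff (a\<^sup>2) (b\<^sup>2) \<le> ennreal (4 * e) * a\<^sup>2 + ennreal (1 + 4 / e) * r\<^sup>2"
proof (cases "r = \<infinity>")
  case True
  have "0 < 1 + 4 / e" using e by (simp add: add_pos_pos)
  then show ?thesis using True by (simp add: ennreal_mult_top power2_eq_square)
next
  case False
  obtain a' where a': "a = ennreal a'" "0 \<le> a'" using a by (cases a) auto
  obtain r' where r': "r = ennreal r'" "0 \<le> r'" using False by (cases r) auto
  have "b < \<infinity>"
    using ba by (rule le_less_trans) (simp add: a' r' ennreal_mult_less_top)
  then obtain b' where b': "b = ennreal b'" "0 \<le> b'" by (cases b) auto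
  have "a' \<le> b' + e * a' + r'" "b' \<le> a' + e * a' + r'"
    using ab ba e a' b' r' by (simp_all flip: ennreal_mult ennreal_plus)
  then have "\<bar>a'\<^sup>2 - b'\<^sup>2\<bar> \<le> 4 * e * a'\<^sup>2 + (1 + 4 / e) * r'\<^sup>2"
    using e a' b' r' by (intro square_diff_le_of_close) auto
  then show ?thesis
    using e a' b' r'
    by (simp add: ennreal_power ennreal_abs_diff_ennreal flip: ennreal_mult ennreal_plus)
qed

text \<open>Multiplication is discontinuous at \<open>0 \<cdot> \<infinity>\<close>, but squaring is continuous on all of
  \<open>[0, \<infinity>]\<close>, so the square of the increasing sequence of tail infima has the expected limit.\<close>

lemma liminf_square_ge:
  fixes X :: "nat \<Rightarrow> ennreal"
  shows "(liminf X)\<^sup>2 \<le> liminf (\<lambda>n. (X n)\<^sup>2)"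
proof -
  define Y where "Y n = (INF m\<in>{n..}. X m)" for n
  have "incseq Y"
    unfolding Y_def incseq_def by (auto intro!: INF_superset_mono)
  then have "Y \<longlonglongrightarrow> liminf X"
    unfolding liminf_SUP_INF Y_def[symmetric] by (rule LIMSEQ_SUP)
  then have "(\<lambda>n. (Y n)\<^sup>2) \<longlonglongrightarrow> (liminf X)\<^sup>2"
    unfolding power2_eq_square by (intro tendsto_mult_ennreal) auto
  then have "(liminf X)\<^sup>2 = liminf (\<lambda>n. (Y n)\<^sup>2)"
    by (simp add: lim_imp_Liminf)
  also have "\<dots> \<le> liminf (\<lambda>n. (X n)\<^sup>2)"
    by (intro Liminf_mono always_eventually allI power_mono) (auto simp: Y_def intro: INF_lower)
  finally show ?thesis .
qed

section \<open>Potentials of a nonnegative kernel\<close>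

text \<open>Measurability of potentials is assumed rather than derived from joint measurability of the
  kernel: for Lebesgue measure, which is complete, the densities are only measurable with respect to
  the completion, and Tonelli's theorem for \<open>lborel\<close> does not apply to them directly.\<close>

locale nonneg_kernel =
  fixes L :: "'a measure" and M :: "'b measure" and K :: "'a \<Rightarrow> 'b \<Rightarrow> ennreal"
  assumes kernel_finite: "K x y < \<infinity>"
    and kernel_measurable [measurable]: "K x \<in> borel_measurable M"
    and potential_measurable_raw:
      "f \<in> borel_measurable M \<Longrightarrow> (\<lambda>x. \<integral>\<^sup>+ y. K x y * f y \<partial>M) \<in> borel_measurable L"
begin

definition potential :: "('b \<Rightarrow> ennreal) \<Rightarrow> 'a \<Rightarrow> ennreal" where
  "potential f x = (\<integral>\<^sup>+ y. K x y * f y \<partial>M)"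

lemma potential_measurable [measurable]:
  "f \<in> borel_measurable M \<Longrightarrow> potential f \<in> borel_measurable L"
  using potential_measurable_raw unfolding potential_def [abs_def] .

lemma potential_mono:
  "(\<And>y. f y \<le> g y) \<Longrightarrow> potential f x \<le> potential g x"
  unfolding potential_def by (intro nn_integral_mono mult_left_mono) auto

lemma potential_add:
  assumes [measurable]: "f \<in> borel_measurable M" "g \<in> borel_measurable M"
  shows "potential (\<lambda>y. f y + g y) x = potential f x + potential g x"
  unfolding potential_def by (simp add: distrib_left nn_integral_add)

lemma potential_cmult:
  assumes [measurable]: "f \<in> borel_measurable M"
  shows "potential (\<lambda>y. c * f y) x = c * potential f x"
  unfolding potential_def by (simp add: nn_integral_cmult[symmetric] mult_ac)

lemma potential_square_Fatou:
  assumes f [measurable]: "\<And>n. f n \<in> borel_measurable M"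
    and lim: "AE y in M. (\<lambda>n. f n y) \<longlonglongrightarrow> h y"
    and bound: "\<And>n. (\<integral>\<^sup>+ x. (potential (f n) x)\<^sup>2 \<partial>L) \<le> B"
  shows "(\<integral>\<^sup>+ x. (potential h x)\<^sup>2 \<partial>L) \<le> B"
proof -
  have le: "potential h x \<le> liminf (\<lambda>n. potential (f n) x)" for x
  proof -
    have "potential h x \<le> (\<integral>\<^sup>+ y. liminf (\<lambda>n. K x y * f n y) \<partial>M)"
      unfolding potential_def
    proof (rule nn_integral_mono_AE, use lim in eventually_elim)
      case (elim y)
      show ?case
      \<comment> \<open>A product that vanishes is a trivial lower bound; this also removes the forms \<open>0 \<cdot> \<infinity>\<close>,
        at which multiplication is discontinuous.\<close>
      proof (cases "K x y * h y = 0")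
        case False
        then have "(\<lambda>n. K x y * f n y) \<longlonglongrightarrow> K x y * h y"
          using elim by (intro tendsto_mult_ennreal) auto
        then show ?thesis by (simp add: lim_imp_Liminf)
      next
        case True
        show ?thesis unfolding True by simp
      qed
    qed
    also have "\<dots> \<le> liminf (\<lambda>n. potential (f n) x)"
      unfolding potential_def by (intro nn_integral_liminf) measurable
    finally show ?thesis .
  qed
  have "(\<integral>\<^sup>+ x. (potential h x)\<^sup>2 \<partial>L) \<le> (\<integral>\<^sup>+ x. liminf (\<lambda>n. (potential (f n) x)\<^sup>2) \<partial>L)"
    by (intro nn_integral_mono order.trans[OF power_mono[OF le] liminf_square_ge]) auto
  also have "\<dots> \<le> liminf (\<lambda>n. \<integral>\<^sup>+ x. (potential (f n) x)\<^sup>2 \<partial>L)"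
    by (intro nn_integral_liminf) measurable
  also have "\<dots> \<le> liminf (\<lambda>n::nat. B)"
    by (intro Liminf_mono always_eventually allI bound)
  also have "\<dots> = B" by (simp add: Liminf_const)
  finally show ?thesis .
qed

text \<open>Square integrability makes \<open>potential w\<close> finite almost everywhere. At such a point \<open>K x \<cdot> w\<close> is
  an integrable majorant, and the potentials tend to 0 there; the majorant of their squares is
  \<open>(potential w)\<^sup>2\<close>.\<close>

lemma potential_square_dominated:
  assumes \<psi> [measurable]: "\<And>n. \<psi> n \<in> borel_measurable M"
    and w [measurable]: "w \<in> borel_measurable M"
    and le: "\<And>n y. \<psi> n y \<le> w y"
    and lim: "AE y in M. (\<lambda>n. \<psi> n y) \<longlonglongrightarrow> 0"
    and fin: "(\<integral>\<^sup>+ x. (potential w x)\<^sup>2 \<partial>L) < \<infinity>"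
  shows "(\<lambda>n. \<integral>\<^sup>+ x. (potential (\<psi> n) x)\<^sup>2 \<partial>L) \<longlonglongrightarrow> 0"
proof -
  have pointwise: "(\<lambda>n. potential (\<psi> n) x) \<longlonglongrightarrow> 0" if x: "potential w x < \<infinity>" for x
  proof -
    have "(\<lambda>n. \<integral>\<^sup>+ y. K x y * \<psi> n y \<partial>M) \<longlonglongrightarrow> (\<integral>\<^sup>+ y. 0 \<partial>M)"
    proof (rule nn_integral_dominated_convergence[where w = "\<lambda>y. K x y * w y"])
      show "AE y in M. (\<lambda>n. K x y * \<psi> n y) \<longlonglongrightarrow> 0"
        using lim
      proof eventually_elim
        case (elim y)
        then have "(\<lambda>n. K x y * \<psi> n y) \<longlonglongrightarrow> K x y * 0"
          using kernel_finite[of x y] by (intro tendsto_mult_ennreal) auto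
        then show ?case by simp
      qed
    qed (use x le in \<open>auto simp: potential_def intro!: mult_left_mono\<close>)
    then show ?thesis by (simp add: potential_def)
  qed
  have "(\<lambda>n. \<integral>\<^sup>+ x. (potential (\<psi> n) x)\<^sup>2 \<partial>L) \<longlonglongrightarrow> (\<integral>\<^sup>+ x. 0 \<partial>L)"
  proof (rule nn_integral_dominated_convergence[where w = "\<lambda>x. (potential w x)\<^sup>2"])
    have "AE x in L. (potential w x)\<^sup>2 \<noteq> \<infinity>"
      using fin by (intro nn_integral_PInf_AE) auto
    then show "AE x in L. (\<lambda>n. (potential (\<psi> n) x)\<^sup>2) \<longlonglongrightarrow> 0"
    proof eventually_elim
      case (elim x)
      then have "potential w x < \<infinity>" by (simp add: less_top power_eq_top_ennreal)
      from tendsto_mult_ennreal[OF pointwise[OF this] pointwise[OF this]]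
      show ?case by (simp add: power2_eq_square)
    qed
  qed (use fin le in \<open>auto intro!: power_mono potential_mono\<close>)
  then show ?thesis by simp
qed

text \<open>The potentials of \<open>f n\<close> and \<open>g n\<close> differ by at most \<open>e\<close> times the potential of \<open>f n\<close> plus the
  potential of the excess \<open>\<psi> n\<close> of \<open>\<bar>f n - g n\<bar>\<close> over \<open>e * f n\<close>. The limit \<open>h\<close> acts as majorant of
  this excess, whence the need to know first that the potential of \<open>h\<close> is square integrable.\<close>

theorem square_potential_splitting:
  fixes f g :: "nat \<Rightarrow> 'b \<Rightarrow> real" and h :: "'b \<Rightarrow> real" and B :: real
  assumes f [measurable]: "\<And>n. f n \<in> borel_measurable M" and f0: "\<And>n y. 0 \<le> f n y"
    and g [measurable]: "\<And>n. g n \<in> borel_measurable M" and g0: "\<And>n y. 0 \<le> g n y"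
    and h [measurable]: "h \<in> borel_measurable M" and h0: "\<And>y. 0 \<le> h y"
    and limf: "AE y in M. (\<lambda>n. f n y) \<longlonglongrightarrow> h y"
    and limg: "AE y in M. (\<lambda>n. g n y) \<longlonglongrightarrow> h y"
    and close: "\<And>e. 0 < e \<Longrightarrow> \<exists>C\<ge>0. \<forall>n y. \<bar>f n y - g n y\<bar> \<le> e * f n y + C * h y"
    and bound: "\<And>n. (\<integral>\<^sup>+ x. (potential (\<lambda>y. ennreal (f n y)) x)\<^sup>2 \<partial>L) \<le> ennreal B"
  shows "(\<lambda>n. \<integral>\<^sup>+ x. ennreal_abs_diff
      ((potential (\<lambda>y. ennreal (f n y)) x)\<^sup>2) ((potential (\<lambda>y. ennreal (g n y)) x)\<^sup>2) \<partial>L)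
    \<longlonglongrightarrow> 0"
    (is "?D \<longlonglongrightarrow> 0")
proof (rule order_tendstoI)
  fix c :: ennreal assume "0 < c"
  then obtain c' where "0 < c'" "c' < c" using dense by blast
  then obtain \<epsilon> where \<epsilon>: "0 < \<epsilon>" "ennreal \<epsilon> < c"
    by (cases c') (auto simp: ennreal_less_zero_iff)
  \<comment> \<open>Half of \<open>\<epsilon>\<close> is for the term \<open>4 e B\<close>, half for the remainder; the summand 1 only guards
    against \<open>B = 0\<close>.\<close>
  define e where "e = min 1 (\<epsilon> / (8 * (\<bar>B\<bar> + 1)))"
  have e: "0 < e" "e \<le> 1" using \<epsilon> by (auto simp: e_def)
  have eB: "4 * e * \<bar>B\<bar> \<le> \<epsilon> / 2"
  proof -
    have "e * \<bar>B\<bar> \<le> \<epsilon> / (8 * (\<bar>B\<bar> + 1)) * (\<bar>B\<bar> + 1)"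
      using \<epsilon> by (intro mult_mono) (auto simp: e_def)
    also have "\<dots> = \<epsilon> / 8" by (simp add: field_simps add_nonneg_eq_0_iff)
    finally show ?thesis by simp
  qed
  obtain C where C: "0 \<le> C" "\<And>n y. \<bar>f n y - g n y\<bar> \<le> e * f n y + C * h y"
    using close[OF e(1)] by blast
  define \<psi> where "\<psi> n y = max 0 (\<bar>f n y - g n y\<bar> - e * f n y)" for n y
  have [measurable]: "\<psi> n \<in> borel_measurable M" for n
    unfolding \<psi>_def [abs_def] by measurable
  have \<psi>0: "0 \<le> \<psi> n y" for n y by (simp add: \<psi>_def)
  have \<psi>_le: "ennreal (\<psi> n y) \<le> ennreal (C * h y)" for n y
    using C(2)[of n y] C(1) h0[of y] by (intro ennreal_leI) (auto simp: \<psi>_def)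
  have \<psi>_lim: "AE y in M. (\<lambda>n. ennreal (\<psi> n y)) \<longlonglongrightarrow> 0"
    using limf limg
  proof eventually_elim
    case (elim y)
    have "(\<lambda>n. \<psi> n y) \<longlonglongrightarrow> max 0 (\<bar>h y - h y\<bar> - e * h y)"
      unfolding \<psi>_def using elim by (intro tendsto_intros)
    then have "(\<lambda>n. \<psi> n y) \<longlonglongrightarrow> 0" using mult_nonneg_nonneg[of e "h y"] e h0[of y] by simp
    then show ?case using tendsto_ennrealI by fastforce
  qed
  have "(\<integral>\<^sup>+ x. (potential (\<lambda>y. ennreal (h y)) x)\<^sup>2 \<partial>L) \<le> ennreal B"
  proof (rule potential_square_Fatou[OF _ _ bound])
    show "AE y in M. (\<lambda>n. ennreal (f n y)) \<longlonglongrightarrow> ennreal (h y)"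
      using limf by eventually_elim (rule tendsto_ennrealI)
  qed measurable
  then have "(\<integral>\<^sup>+ x. (potential (\<lambda>y. ennreal (h y)) x)\<^sup>2 \<partial>L) < \<infinity>"
    by (rule le_less_trans) simp
  moreover have "(potential (\<lambda>y. ennreal (C * h y)) x)\<^sup>2
      = ennreal (C\<^sup>2) * (potential (\<lambda>y. ennreal (h y)) x)\<^sup>2" for x
    using C(1) h0
    by (simp add: ennreal_mult potential_cmult power_mult_distrib flip: ennreal_power)
  ultimately have fin: "(\<integral>\<^sup>+ x. (potential (\<lambda>y. ennreal (C * h y)) x)\<^sup>2 \<partial>L) < \<infinity>"
    by (simp add: nn_integral_cmult ennreal_mult_less_top)
  define R where "R n = (\<integral>\<^sup>+ x. (potential (\<lambda>y. ennreal (\<psi> n y)) x)\<^sup>2 \<partial>L)" for n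
  have "R \<longlonglongrightarrow> 0"
    unfolding R_def by (rule potential_square_dominated[OF _ _ \<psi>_le \<psi>_lim fin]) measurable
  then have "(\<lambda>n. ennreal (1 + 4 / e) * R n) \<longlonglongrightarrow> ennreal (1 + 4 / e) * 0"
    by (intro tendsto_mult_ennreal tendsto_const) auto
  then have "\<forall>\<^sub>F n in sequentially. ennreal (1 + 4 / e) * R n < ennreal (\<epsilon> / 2)"
    using \<epsilon> by (intro order_tendstoD(2)) auto
  then show "\<forall>\<^sub>F n in sequentially. ?D n < c"
  proof eventually_elim
    case (elim n)
    let ?a = "potential (\<lambda>y. ennreal (f n y))" and ?b = "potential (\<lambda>y. ennreal (g n y))"
    let ?r = "potential (\<lambda>y. ennreal (\<psi> n y))"
    have pot: "potential (\<lambda>y. ennreal (k y) + ennreal e * ennreal (f n y) + ennreal (\<psi> n y)) x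
        = potential (\<lambda>y. ennreal (k y)) x + ennreal e * ?a x + ?r x"
      if [measurable]: "k \<in> borel_measurable M" for k x
      by (simp add: potential_add potential_cmult)
    have ab: "?a x \<le> ?b x + ennreal e * ?a x + ?r x" for x
    proof (subst pot[symmetric], measurable, rule potential_mono)
      fix y show "ennreal (f n y) \<le> ennreal (g n y) + ennreal e * ennreal (f n y) + ennreal (\<psi> n y)"
        using e f0[of n y] g0[of n y] \<psi>0[of n y]
        by (auto simp: \<psi>_def simp flip: ennreal_mult ennreal_plus)
    qed
    have ba: "?b x \<le> ?a x + ennreal e * ?a x + ?r x" for x
    proof (subst pot[symmetric], measurable, rule potential_mono)
      fix y show "ennreal (g n y) \<le> ennreal (f n y) + ennreal e * ennreal (f n y) + ennreal (\<psi> n y)"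
        using e f0[of n y] g0[of n y] \<psi>0[of n y]
        by (auto simp: \<psi>_def simp flip: ennreal_mult ennreal_plus)
    qed
    have "(\<integral>\<^sup>+ x. (?a x)\<^sup>2 \<partial>L) < \<infinity>"
      using bound[of n] by (rule le_less_trans) simp
    then have "AE x in L. (?a x)\<^sup>2 \<noteq> \<infinity>"
      by (intro nn_integral_PInf_AE) auto
    then have "?D n \<le> (\<integral>\<^sup>+ x. ennreal (4 * e) * (?a x)\<^sup>2 + ennreal (1 + 4 / e) * (?r x)\<^sup>2 \<partial>L)"
    proof (intro nn_integral_mono_AE, eventually_elim)
      case (elim x)
      then have "?a x < \<infinity>" by (simp add: less_top power_eq_top_ennreal)
      then show ?case using e ab ba by (intro ennreal_square_diff_le_of_close)
    qed
    also have "\<dots> = ennreal (4 * e) * (\<integral>\<^sup>+ x. (?a x)\<^sup>2 \<partial>L) + ennreal (1 + 4 / e) * R n"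
      by (simp add: nn_integral_add nn_integral_cmult R_def)
    also have "\<dots> \<le> ennreal (4 * e) * ennreal \<bar>B\<bar> + ennreal (1 + 4 / e) * R n"
      using order.trans[OF bound[of n] ennreal_leI[of B "\<bar>B\<bar>"]]
      by (intro add_right_mono mult_left_mono) auto
    also have "\<dots> \<le> ennreal (\<epsilon> / 2) + ennreal (1 + 4 / e) * R n"
      using e eB by (intro add_right_mono) (auto simp flip: ennreal_mult intro: ennreal_leI)
    also have "\<dots> < ennreal (\<epsilon> / 2) + ennreal (\<epsilon> / 2)"
      using elim by (simp add: ennreal_add_left_cancel_less)
    also have "\<dots> = ennreal \<epsilon>"
      using \<epsilon> by (simp flip: ennreal_plus)
    finally show "?D n < c" using \<epsilon>(2) by (rule less_trans)
  qed
qed simp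

end

section \<open>The Riesz kernel on Lebesgue measure\<close>

text \<open>The pointwise limit may fail to exist on a null set, where \<open>v\<close> is arbitrary; completeness of
  Lebesgue measure makes this harmless.\<close>

lemma lebesgue_measurable_AE_limit:
  fixes u :: "nat \<Rightarrow> 'a::euclidean_space \<Rightarrow> real"
  assumes u [measurable]: "\<And>n. u n \<in> borel_measurable lebesgue"
    and lim: "AE x in lebesgue. (\<lambda>n. u n x) \<longlonglongrightarrow> v x"
  shows "v \<in> borel_measurable lebesgue"
proof (rule measurableI)
  fix A :: "real set" assume A [measurable]: "A \<in> sets borel"
  define w where "w x = lim (\<lambda>n. u n x)" for x
  have [measurable]: "w \<in> borel_measurable lebesgue"
    unfolding w_def [abs_def] by measurable
  have "AE x in lebesgue. x \<in> w -` A \<longleftrightarrow> x \<in> v -` A"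
    using lim by eventually_elim (simp add: w_def limI)
  moreover have "w -` A \<in> sets lebesgue"
    using measurable_sets[of w lebesgue borel A] by simp
  ultimately have "v -` A \<in> sets lebesgue"
    by (rule complete_measure.in_sets_AE[OF completion.complete_measure_axioms]) simp
  then show "v -` A \<inter> space lebesgue \<in> sets lebesgue" by simp
qed simp

text \<open>For the measurability of potentials, replace the density by a Borel function that equals it
  almost everywhere. This changes no potential at any point, and then Tonelli's theorem applies on
  \<open>lborel\<close>.\<close>

interpretation riesz: nonneg_kernel lebesgue lebesgue
  "\<lambda>x y :: real ^ 'n. ennreal (riesz_kernel \<alpha> (x - y))" for \<alpha>
proof
  fix x :: "real ^ 'n"
  have "(\<lambda>y. ennreal (riesz_kernel \<alpha> (x - y))) \<in> borel_measurable lborel"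
    unfolding riesz_kernel_def by measurable
  then show "(\<lambda>y. ennreal (riesz_kernel \<alpha> (x - y))) \<in> borel_measurable lebesgue"
    by (rule measurable_completion)
next
  fix f :: "real ^ 'n \<Rightarrow> ennreal" assume "f \<in> borel_measurable lebesgue"
  then obtain f' where [measurable]: "f' \<in> borel_measurable lborel"
    and f': "AE y in lborel. f y = f' y"
    using completion_ex_borel_measurable by blast
  have "(\<integral>\<^sup>+ y. ennreal (riesz_kernel \<alpha> (x - y)) * f y \<partial>lebesgue)
      = (\<integral>\<^sup>+ y. ennreal (riesz_kernel \<alpha> (x - y)) * f' y \<partial>lborel)" for x
    unfolding nn_integral_completion
    by (rule nn_integral_cong_AE) (use f' in \<open>auto elim: eventually_mono\<close>)
  moreover have "(\<lambda>x. \<integral>\<^sup>+ y. ennreal (riesz_kernel \<alpha> (x - y)) * f' y \<partial>lborel)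
      \<in> borel_measurable lborel"
    unfolding riesz_kernel_def by measurable
  ultimately show "(\<lambda>x. \<integral>\<^sup>+ y. ennreal (riesz_kernel \<alpha> (x - y)) * f y \<partial>lebesgue)
      \<in> borel_measurable lebesgue"
    by (simp add: measurable_completion)
qed simp

lemma riesz_conv_eq_potential: "riesz_conv \<alpha> f = riesz.potential \<alpha> f"
  by (rule ext) (simp add: riesz_conv_def riesz.potential_def)

theorem proposition4p1:
  fixes \<alpha> p :: real
    and u :: "nat \<Rightarrow> real ^ 'n \<Rightarrow> real"
    and v :: "real ^ 'n \<Rightarrow> real"
  assumes "0 < \<alpha>" and "\<alpha> < real CARD('n)"
    and "1 \<le> p"
    and "\<And>n. u n \<in> borel_measurable lebesgue"
    and "AE x in lebesgue. (\<lambda>n. u n x) \<longlonglongrightarrow> v x"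
    and "L2_bounded (\<lambda>n. riesz_conv (\<alpha> / 2) (\<lambda>y. ennreal (\<bar>u n y\<bar> powr p)))"
  shows "(\<lambda>n. \<integral>\<^sup>+ x. ennreal_abs_diff
             ((riesz_conv (\<alpha> / 2) (\<lambda>y. ennreal (\<bar>u n y\<bar> powr p)) x)\<^sup>2)
             ((riesz_conv (\<alpha> / 2)
                 (\<lambda>y. ennreal (\<bar>u n y - v y\<bar> powr p + \<bar>v y\<bar> powr p)) x)\<^sup>2) \<partial>lebesgue)
           \<longlonglongrightarrow> 0"
proof -
  note u [measurable] = assms(4) and lim = assms(5)
  note v [measurable] = lebesgue_measurable_AE_limit[OF u lim]
  obtain C where C: "\<And>n. (\<integral>\<^sup>+ x. (riesz.potential (\<alpha> / 2)
      (\<lambda>y. ennreal (\<bar>u n y\<bar> powr p)) x)\<^sup>2 \<partial>lebesgue) \<le> ennreal (C\<^sup>2)"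
    using assms(6) unfolding L2_bounded_def riesz_conv_eq_potential by blast
  show ?thesis
    unfolding riesz_conv_eq_potential
  proof (rule riesz.square_potential_splitting[where h = "\<lambda>y. \<bar>v y\<bar> powr p", OF _ _ _ _ _ _ _ _ _ C])
    show "AE y in lebesgue. (\<lambda>n. \<bar>u n y\<bar> powr p) \<longlonglongrightarrow> \<bar>v y\<bar> powr p"
      using lim by eventually_elim (use \<open>1 \<le> p\<close> in \<open>auto intro!: tendsto_intros tendsto_powr'\<close>)
    show "AE y in lebesgue. (\<lambda>n. \<bar>u n y - v y\<bar> powr p + \<bar>v y\<bar> powr p) \<longlonglongrightarrow> \<bar>v y\<bar> powr p"
      using lim
    proof eventually_elim
      case (elim y)
      have "(\<lambda>n. \<bar>u n y - v y\<bar> powr p + \<bar>v y\<bar> powr p) \<longlonglongrightarrow> \<bar>v y - v y\<bar> powr p + \<bar>v y\<bar> powr p"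
        using elim \<open>1 \<le> p\<close> by (intro tendsto_add tendsto_powr' tendsto_rabs tendsto_diff tendsto_const) auto
      then show ?case by simp
    qed
    show "\<exists>C\<ge>0. \<forall>n y. \<bar>\<bar>u n y\<bar> powr p - (\<bar>u n y - v y\<bar> powr p + \<bar>v y\<bar> powr p)\<bar>
        \<le> e * \<bar>u n y\<bar> powr p + C * \<bar>v y\<bar> powr p" if "0 < e" for e
      using powr_splitting[of p e] that \<open>1 \<le> p\<close> by fastforce
  qed auto
qed

end
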